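(* (Strong duality) Let $\bar x\in C$ be such that the robust (KKT) condition is satisfied at $\bar x$. Then there exists $(\bar y^*,\bar\mu)\in(K^+\setminus\{0\})\times\mathbb R^n_+$ such that $(\bar x,\bar y^*,\bar\mu)\in C_D$. Moreover: (i) If $(f\circ F,g\circ G)$ is type I pseudo convex at $z$ for all $z\in X$, then $(\bar x,\bar y^*,\bar\mu)\in\mathcal S^w(\mathrm{CRD})$ and $\bar x\in\mathcal S^w(\mathrm{CRP})$. (ii) If $(f\circ F,g\circ G)$ is type II pseudo convex at $z$ for all $z\in X$, then $(\bar x,\bar y^*,\bar\mu)\in\mathcal S(\mathrm{CRD})$ and $\bar x\in\mathcal S(\mathrm{CRP})$.
   Context: Setting. $X,W,Y,Z$ are Asplund spaces; $F:X\to W$, $f:W\to Y$; $K\subset Y$ is a pointed closed convex cone with nonempty interior; $K^+=\{y^*\in Y^*\mid\langle y^*,y\rangle\ge 0\ \forall y\in K\}$. For $i=1,\dots,n$, $\mathcal V_i$ is a (nonempty) sequentially compact topological space, $\mathcal U_i$ a topological space, $G_i:X\times\mathcal V_i\to Z\times\mathcal U_i$, $g_i:Z\times\mathcal U_i\to\mathbb R$. The primal robust problem $(\mathrm{CRP})$ is: minimize $(f\circ F)(x)$ with respect to $K$ over $C=\{x\in X\mid (g_i\circ G_i)(x,v_i)\le 0\ \forall v_i\in\mathcal V_i,\ i=1,\dots,n\}$; $\bar x\in\mathcal S(\mathrm{CRP})$ (resp. $\mathcal S^w(\mathrm{CRP})$) means $\bar x\in C$ and $(f\circ F)(x)-(f\circ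 F)(\bar x)\notin-K\setminus\{0\}$ (resp. $\notin-\mathrm{int}\,K$) for all $x\in C$. Notation. $\partial$ is the limiting (Mordukhovich) subdifferential. $\langle y^*,f\rangle(w):=\langle y^*,f(w)\rangle$. $\mathrm{cl}^*\mathrm{co}$ is the weak$^*$ closed convex hull. $\partial_x$ is the limiting subdifferential in the first variable with the parameter held fixed; writing $G_i(x,v_i)=(\tilde G_i(x,v_i),\gamma_i(x,v_i))\in Z\times\mathcal U_i$, $\partial_x g_i(G_i(z,v_i))\subset Z^*$ is the limiting subdifferential of $g_i(\cdot,\gamma_i(z,v_i))$ at $\tilde G_i(z,v_i)$, and $\langle v_i^*,G_i\rangle(x,v_i):=\langle v_i^*,\tilde G_i(x,v_i)\rangle$. Put $\phi_i(x)=\max_{v_i\in\mathcal V_i}(g_i\circ G_i)(x,v_i)$, $\phi=\max_i\phi_i$, $\mathcal V_i(z)=\{v_i\in\mathcal V_i\mid(g_i\circ G_i)(z,v_i)=\phi_i(z)\}$, and $$\Delta_i(z):=\mathrm{cl}^*\mathrm{co}\Big(\bigcup\Big\{\bigcup_{v_i^*\in\partial_x g_i(G_i(z,v_i))}\partial_x\langle v_i^*,G_i\rangle(z,v_i)\Big|v_i\in\mathcal V_i(z)\Big\}\Big).$$ Standing assumptions at $\bar x$. (A1) $F$ is locally Lipschitz at $\bar x$ and $f$ at $F(\bar x)$. (A2) $\tilde G_i(\cdot,v_i)$ is Lipschitz on a neighborhood of $\bar x$ uniformly in $v_i\in\mathcal V_i$, and $g_i$ is Lipschitz in its $Z$-variable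 (uniformly) around the points of $G_i(\bar x,\mathcal V_i)$. (A3) $v_i\mapsto G_i(\bar x,v_i)$ and $g_i$ on $G_i(\bar x,\mathcal V_i)$ are locally Lipschitz (with respect to metrics inducing the topologies of $\mathcal V_i,\mathcal U_i$). (A4) $\phi_i,\phi$ are well-defined real-valued functions on $X$ (maxima attained), locally Lipschitz at $\bar x$. (A5) The multifunction $(x,v_i)\mapsto\partial_x(g_i\circ G_i)(x,v_i)$ is weak$^*$ sequentially closed at $(\bar x,\bar v_i)$ for each $\bar v_i\in\mathcal V_i(\bar x)$. Robust (KKT) condition at $\bar x\in C$: there exist $y^*\in K^+\setminus\{0\}$, $\mu\in\mathbb R^n_+$ and $\bar v_i\in\mathcal V_i$ such that $0\in\bigcup_{w^*\in\partial\langle y^*,f\rangle(F(\bar x))}\partial\langle w^*,F\rangle(\bar x)+\sum_{i=1}^n\mu_i\,\Delta_i(\bar x)$ and $\mu_i\max_{v_i\in\mathcal V_i}(g_i\circ G_i)(\bar x,v_i)=\mu_i(g_i\circ G_i)(\bar x,\bar v_i)=0$, $i=1,\dots,n$. Dual problem $(\mathrm{CRD})$: maximize $\bar f(z,y^*,\mu):=(f\circ F)(z)$ with respect to $K$ over the set $C_D$ of all $(z,y^*,\mu)\in X\times(K^+\setminus\{0\})\times\mathbb R^n_+$ such that $$0\in\bigcup_{w^*\in\partial\langle y^*,f\rangle(F(z))}\partial\langle w^*,F\rangle(z)+\sum_{i=1}^n\mu_i\,\Delta_i(z)$$ and $\mu_i\,g_i(G_i(z,v_i))\ge 0$ for $v_i\in\mathcal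 V_i(z)$, $i=1,\dots,n$. A point $p\in C_D$ belongs to $\mathcal S(\mathrm{CRD})$ (resp. $\mathcal S^w(\mathrm{CRD})$) if $\bar f(q)-\bar f(p)\notin K\setminus\{0\}$ (resp. $\notin\mathrm{int}\,K$) for all $q\in C_D$. Pseudo convexity. $(f\circ F,g\circ G)$ is type I pseudo convex at $z\in X$ if for any $x\in X$, $y^*\in K^+$, $w^*\in\partial\langle y^*,f\rangle(F(z))$, $x^*\in\partial\langle w^*,F\rangle(z)$, $v_i^*\in\partial_x g_i(G_i(z,v_i))$, and $x_i^*\in\partial_x\langle v_i^*,G_i\rangle(z,v_i)$, $v_i\in\mathcal V_i(z)$, $i=1,\dots,n$, there exists $\nu\in X$ such that $\langle y^*,f\circ F\rangle(x)<\langle y^*,f\circ F\rangle(z)\Rightarrow\langle x^*,\nu\rangle<0$, and $(g_i\circ G_i)(x,v_i)\le(g_i\circ G_i)(z,v_i)\Rightarrow\langle x_i^*,\nu\rangle\le 0$, $i=1,\dots,n$. It is type II pseudo convex at $z$ if the same holds for any $x\in X\setminus\{z\}$ and $y^*\in K^+\setminus\{0\}$ (other data as before), with the first implication replaced by $\langle y^*,f\circ F\rangle(x)\le\langle y^*,f\circ F\rangle(z)\Rightarrow\langle x^*,\nu\rangle<0$.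
   Formalization: In type I and type II pseudo convexity, ν may depend on x, y*, w*, x* but must serve all v_i, v_i*, x_i* at once; if ν may also depend on v_i, v_i*, x_i*, the claim is false (minimize x₃ on R³ subject to ±x₁ − x₂² − x₃ ≤ 0, at 0). *)

theory Defs
  imports "HOL-Analysis.Analysis"
begin

section \<open>Variational analysis in Asplund spaces\<close>

definition asplund :: "'a::banach itself \<Rightarrow> bool" where
  "asplund _ \<longleftrightarrow>
    (\<forall>(U :: 'a set) (\<phi> :: 'a \<Rightarrow> real).
       open U \<and> convex U \<and> convex_on U \<phi> \<and> continuous_on U \<phi> \<longrightarrow>
       U \<subseteq> closure {u \<in> U. \<phi> differentiable (at u)})"

text \<open>For real-valued functionals the strong operator topology is the topology of pointwise
  convergence, i.e. the weak* topology of the dual.\<close>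

abbreviation weak_star :: "('a::real_normed_vector \<Rightarrow>\<^sub>L real) topology" where
  "weak_star \<equiv> strong_operator_topology"

definition clco :: "('a::real_normed_vector \<Rightarrow>\<^sub>L real) set \<Rightarrow> ('a \<Rightarrow>\<^sub>L real) set" where
  "clco S = weak_star closure_of (convex hull S)"

definition frechet_normal_cone ::
    "'a::real_normed_vector \<Rightarrow> 'a set \<Rightarrow> ('a \<Rightarrow>\<^sub>L real) set" where
  "frechet_normal_cone x \<Omega> =
    (if x \<in> \<Omega>
     then {p. Limsup (at x within \<Omega>)
                (\<lambda>u. ereal (blinfun_apply p (u - x) / norm (u - x))) \<le> 0}
     else {})"

text \<open>Sequential outer limit of the Frechet normal cones. As usual in Asplund spaces, no
  \<open>\<epsilon>\<close>-enlargements of the Frechet normals are involved.\<close>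

definition limiting_normal_cone ::
    "'a::real_normed_vector \<Rightarrow> 'a set \<Rightarrow> ('a \<Rightarrow>\<^sub>L real) set" where
  "limiting_normal_cone x \<Omega> =
    (if x \<in> \<Omega>
     then {p. \<exists>(u :: nat \<Rightarrow> 'a) (q :: nat \<Rightarrow> 'a \<Rightarrow>\<^sub>L real).
              (\<forall>k. u k \<in> \<Omega>) \<and> u \<longlonglongrightarrow> x \<and>
              (\<forall>k. q k \<in> frechet_normal_cone (u k) \<Omega>) \<and>
              limitin weak_star q p sequentially}
     else {})"

text \<open>\<open>(p o\<^sub>L fst_blinfun) - snd_blinfun\<close> is the functional \<open>(p, -1)\<close> on the product
  with the real line.\<close>

definition limiting_subdiff ::
    "('a::real_normed_vector \<Rightarrow> real) \<Rightarrow> 'a \<Rightarrow> ('a \<Rightarrow>\<^sub>L real) set" where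
  "limiting_subdiff \<phi> x =
    {p. (p o\<^sub>L fst_blinfun) - snd_blinfun \<in> limiting_normal_cone (x, \<phi> x) (epigraph UNIV \<phi>)}"

definition locally_lipschitz_at ::
    "('a::metric_space \<Rightarrow> 'b::metric_space) \<Rightarrow> 'a \<Rightarrow> bool" where
  "locally_lipschitz_at h x \<longleftrightarrow> (\<exists>e>0. \<exists>L. L-lipschitz_on (ball x e) h)"

definition locally_Lipschitz_map :: "'a metric \<Rightarrow> 'b metric \<Rightarrow> ('a \<Rightarrow> 'b) \<Rightarrow> bool" where
  "locally_Lipschitz_map m1 m2 h \<longleftrightarrow>
    (\<forall>a \<in> mspace m1. \<exists>r>0. Lipschitz_continuous_map (submetric m1 (mball_of m1 a r)) m2 h)"

definition seq_compact_space :: "'a topology \<Rightarrow> bool" where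
  "seq_compact_space T \<longleftrightarrow>
    (\<forall>s :: nat \<Rightarrow> 'a. range s \<subseteq> topspace T \<longrightarrow>
       (\<exists>l r. strict_mono r \<and> limitin T (s \<circ> r) l sequentially))"


section \<open>The ordering cone\<close>

definition pointed_closed_convex_cone :: "'y::real_normed_vector set \<Rightarrow> bool" where
  "pointed_closed_convex_cone K \<longleftrightarrow> closed K \<and> convex K \<and> cone K \<and> K \<inter> uminus ` K = {0}"

definition dual_cone :: "'y::real_normed_vector set \<Rightarrow> ('y \<Rightarrow>\<^sub>L real) set" where
  "dual_cone K = {q. \<forall>y\<in>K. 0 \<le> blinfun_apply q y}"


section \<open>The constraint data for one index\<close>

text \<open>Here \<open>G :: 'x \<times> 'v \<Rightarrow> 'z \<times> 'u\<close>, and the parameter set is the carrier of the topology \<open>V\<close>.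
  The maximum over the parameters is written as a supremum; attainment is part of assumption (A4).\<close>

definition worst_value ::
    "'v topology \<Rightarrow> ('x \<times> 'v \<Rightarrow> 'z \<times> 'u) \<Rightarrow> ('z \<times> 'u \<Rightarrow> real) \<Rightarrow> 'x \<Rightarrow> real" where
  "worst_value V G g x = (SUP v \<in> topspace V. g (G (x, v)))"

definition active_params ::
    "'v topology \<Rightarrow> ('x \<times> 'v \<Rightarrow> 'z \<times> 'u) \<Rightarrow> ('z \<times> 'u \<Rightarrow> real) \<Rightarrow> 'x \<Rightarrow> 'v set" where
  "active_params V G g z = {v \<in> topspace V. g (G (z, v)) = worst_value V G g z}"

definition outer_subdiff ::
    "('x \<times> 'v \<Rightarrow> 'z::real_normed_vector \<times> 'u) \<Rightarrow> ('z \<times> 'u \<Rightarrow> real) \<Rightarrow> 'x \<Rightarrow> 'v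
      \<Rightarrow> ('z \<Rightarrow>\<^sub>L real) set" where
  "outer_subdiff G g z v = limiting_subdiff (\<lambda>p. g (p, snd (G (z, v)))) (fst (G (z, v)))"

definition inner_subdiff ::
    "('x::real_normed_vector \<times> 'v \<Rightarrow> 'z::real_normed_vector \<times> 'u) \<Rightarrow> ('z \<Rightarrow>\<^sub>L real)
      \<Rightarrow> 'x \<Rightarrow> 'v \<Rightarrow> ('x \<Rightarrow>\<^sub>L real) set" where
  "inner_subdiff G q z v = limiting_subdiff (\<lambda>x. blinfun_apply q (fst (G (x, v)))) z"

definition Delta ::
    "'v topology \<Rightarrow> ('x::real_normed_vector \<times> 'v \<Rightarrow> 'z::real_normed_vector \<times> 'u)
      \<Rightarrow> ('z \<times> 'u \<Rightarrow> real) \<Rightarrow> 'x \<Rightarrow> ('x \<Rightarrow>\<^sub>L real) set" where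
  "Delta V G g z =
    clco (\<Union>v \<in> active_params V G g z. \<Union>q \<in> outer_subdiff G g z v. inner_subdiff G q z v)"

definition objective_subdiff ::
    "('w::real_normed_vector \<Rightarrow> 'y::real_normed_vector) \<Rightarrow> ('x::real_normed_vector \<Rightarrow> 'w)
      \<Rightarrow> ('y \<Rightarrow>\<^sub>L real) \<Rightarrow> 'x \<Rightarrow> ('x \<Rightarrow>\<^sub>L real) set" where
  "objective_subdiff f F ys z =
    (\<Union>ws \<in> limiting_subdiff (\<lambda>w. blinfun_apply ys (f w)) (F z).
       limiting_subdiff (\<lambda>x. blinfun_apply ws (F x)) z)"


section \<open>Standing assumptions\<close>

definition assumption_A1 ::
    "('w::metric_space \<Rightarrow> 'y::metric_space) \<Rightarrow> ('x::metric_space \<Rightarrow> 'w) \<Rightarrow> 'x \<Rightarrow> bool" where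
  "assumption_A1 f F xbar \<longleftrightarrow> locally_lipschitz_at F xbar \<and> locally_lipschitz_at f (F xbar)"

definition assumption_A2 ::
    "'v topology \<Rightarrow> ('x::metric_space \<times> 'v \<Rightarrow> 'z::metric_space \<times> 'u) \<Rightarrow> ('z \<times> 'u \<Rightarrow> real)
      \<Rightarrow> 'x \<Rightarrow> bool" where
  "assumption_A2 V G g xbar \<longleftrightarrow>
    (\<exists>e>0. \<exists>L. \<forall>v\<in>topspace V. L-lipschitz_on (ball xbar e) (\<lambda>x. fst (G (x, v)))) \<and>
    (\<exists>e>0. \<exists>L. \<forall>v\<in>topspace V.
       L-lipschitz_on (ball (fst (G (xbar, v))) e) (\<lambda>p. g (p, snd (G (xbar, v)))))"

definition assumption_A3 ::
    "'v topology \<Rightarrow> 'u topology \<Rightarrow> ('x \<times> 'v \<Rightarrow> 'z::metric_space \<times> 'u) \<Rightarrow> ('z \<times> 'u \<Rightarrow> real)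
      \<Rightarrow> 'x \<Rightarrow> bool" where
  "assumption_A3 V U G g xbar \<longleftrightarrow>
    (\<exists>mV mU. mtopology_of mV = V \<and> mtopology_of mU = U \<and>
       locally_Lipschitz_map mV (prod_metric euclidean_metric mU) (\<lambda>v. G (xbar, v)) \<and>
       locally_Lipschitz_map
         (submetric (prod_metric euclidean_metric mU) ((\<lambda>v. G (xbar, v)) ` topspace V))
         euclidean_metric g)"

definition assumption_A4 ::
    "('n::finite \<Rightarrow> 'v topology) \<Rightarrow> ('n \<Rightarrow> 'x::metric_space \<times> 'v \<Rightarrow> 'z \<times> 'u)
      \<Rightarrow> ('n \<Rightarrow> 'z \<times> 'u \<Rightarrow> real) \<Rightarrow> 'x \<Rightarrow> bool" where
  "assumption_A4 V G g xbar \<longleftrightarrow>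
    (\<forall>i x. \<exists>v\<in>topspace (V i). \<forall>v'\<in>topspace (V i). g i (G i (x, v')) \<le> g i (G i (x, v))) \<and>
    (\<forall>i. locally_lipschitz_at (worst_value (V i) (G i) (g i)) xbar) \<and>
    locally_lipschitz_at (\<lambda>x. MAX i. worst_value (V i) (G i) (g i) x) xbar"

definition assumption_A5 ::
    "'v topology \<Rightarrow> ('x::real_normed_vector \<times> 'v \<Rightarrow> 'z \<times> 'u) \<Rightarrow> ('z \<times> 'u \<Rightarrow> real)
      \<Rightarrow> 'x \<Rightarrow> bool" where
  "assumption_A5 V G g xbar \<longleftrightarrow>
    (\<forall>vbar \<in> active_params V G g xbar.
      \<forall>(xs :: nat \<Rightarrow> 'x) (vs :: nat \<Rightarrow> 'v) (ps :: nat \<Rightarrow> 'x \<Rightarrow>\<^sub>L real) p.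
        xs \<longlonglongrightarrow> xbar \<and> range vs \<subseteq> topspace V \<and> limitin V vs vbar sequentially \<and>
        (\<forall>k. ps k \<in> limiting_subdiff (\<lambda>x. g (G (x, vs k))) (xs k)) \<and>
        limitin weak_star ps p sequentially \<longrightarrow>
        p \<in> limiting_subdiff (\<lambda>x. g (G (x, vbar))) xbar)"


section \<open>The primal problem (CRP)\<close>

definition CRP_feasible ::
    "('n::finite \<Rightarrow> 'v topology) \<Rightarrow> ('n \<Rightarrow> 'x \<times> 'v \<Rightarrow> 'z \<times> 'u) \<Rightarrow> ('n \<Rightarrow> 'z \<times> 'u \<Rightarrow> real)
      \<Rightarrow> 'x set" where
  "CRP_feasible V G g = {x. \<forall>i. \<forall>v\<in>topspace (V i). g i (G i (x, v)) \<le> 0}"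

definition CRP_solutions ::
    "('w \<Rightarrow> 'y::real_normed_vector) \<Rightarrow> ('x \<Rightarrow> 'w) \<Rightarrow> 'y set \<Rightarrow> ('n::finite \<Rightarrow> 'v topology)
      \<Rightarrow> ('n \<Rightarrow> 'x \<times> 'v \<Rightarrow> 'z \<times> 'u) \<Rightarrow> ('n \<Rightarrow> 'z \<times> 'u \<Rightarrow> real) \<Rightarrow> 'x set" where
  "CRP_solutions f F K V G g =
    {xb \<in> CRP_feasible V G g. \<forall>x\<in>CRP_feasible V G g. f (F x) - f (F xb) \<notin> uminus ` (K - {0})}"

definition CRP_weak_solutions ::
    "('w \<Rightarrow> 'y::real_normed_vector) \<Rightarrow> ('x \<Rightarrow> 'w) \<Rightarrow> 'y set \<Rightarrow> ('n::finite \<Rightarrow> 'v topology)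
      \<Rightarrow> ('n \<Rightarrow> 'x \<times> 'v \<Rightarrow> 'z \<times> 'u) \<Rightarrow> ('n \<Rightarrow> 'z \<times> 'u \<Rightarrow> real) \<Rightarrow> 'x set" where
  "CRP_weak_solutions f F K V G g =
    {xb \<in> CRP_feasible V G g. \<forall>x\<in>CRP_feasible V G g. f (F x) - f (F xb) \<notin> uminus ` interior K}"

text \<open>Sums of sets are Minkowski sums.\<close>

definition robust_KKT ::
    "('w::real_normed_vector \<Rightarrow> 'y::real_normed_vector) \<Rightarrow> ('x::real_normed_vector \<Rightarrow> 'w)
      \<Rightarrow> 'y set \<Rightarrow> ('n::finite \<Rightarrow> 'v topology)
      \<Rightarrow> ('n \<Rightarrow> 'x \<times> 'v \<Rightarrow> 'z::real_normed_vector \<times> 'u) \<Rightarrow> ('n \<Rightarrow> 'z \<times> 'u \<Rightarrow> real)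
      \<Rightarrow> 'x \<Rightarrow> bool" where
  "robust_KKT f F K V G g xbar \<longleftrightarrow>
    (\<exists>ys (\<mu> :: real^'n) (vbar :: 'n \<Rightarrow> 'v).
       ys \<in> dual_cone K - {0} \<and> (\<forall>i. 0 \<le> \<mu> $ i) \<and> (\<forall>i. vbar i \<in> topspace (V i)) \<and>
       0 \<in> objective_subdiff f F ys xbar
            + (\<Sum>i\<in>UNIV. (\<lambda>p. \<mu> $ i *\<^sub>R p) ` Delta (V i) (G i) (g i) xbar) \<and>
       (\<forall>i. \<mu> $ i * worst_value (V i) (G i) (g i) xbar = \<mu> $ i * g i (G i (xbar, vbar i)) \<and>
            \<mu> $ i * g i (G i (xbar, vbar i)) = 0))"


section \<open>The dual problem (CRD)\<close>

definition CRD_feasible ::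
    "('w::real_normed_vector \<Rightarrow> 'y::real_normed_vector) \<Rightarrow> ('x::real_normed_vector \<Rightarrow> 'w)
      \<Rightarrow> 'y set \<Rightarrow> ('n::finite \<Rightarrow> 'v topology)
      \<Rightarrow> ('n \<Rightarrow> 'x \<times> 'v \<Rightarrow> 'z::real_normed_vector \<times> 'u) \<Rightarrow> ('n \<Rightarrow> 'z \<times> 'u \<Rightarrow> real)
      \<Rightarrow> ('x \<times> ('y \<Rightarrow>\<^sub>L real) \<times> (real^'n)) set" where
  "CRD_feasible f F K V G g =
    {(z, ys, \<mu>). ys \<in> dual_cone K - {0} \<and> (\<forall>i. 0 \<le> \<mu> $ i) \<and>
       0 \<in> objective_subdiff f F ys z
            + (\<Sum>i\<in>UNIV. (\<lambda>p. \<mu> $ i *\<^sub>R p) ` Delta (V i) (G i) (g i) z) \<and>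
       (\<forall>i. \<forall>v \<in> active_params (V i) (G i) (g i) z. 0 \<le> \<mu> $ i * g i (G i (z, v)))}"

definition CRD_objective :: "('w \<Rightarrow> 'y) \<Rightarrow> ('x \<Rightarrow> 'w) \<Rightarrow> 'x \<times> 'a \<times> 'b \<Rightarrow> 'y" where
  "CRD_objective f F = (\<lambda>(z, ys, \<mu>). f (F z))"

definition CRD_solutions ::
    "('w::real_normed_vector \<Rightarrow> 'y::real_normed_vector) \<Rightarrow> ('x::real_normed_vector \<Rightarrow> 'w)
      \<Rightarrow> 'y set \<Rightarrow> ('n::finite \<Rightarrow> 'v topology)
      \<Rightarrow> ('n \<Rightarrow> 'x \<times> 'v \<Rightarrow> 'z::real_normed_vector \<times> 'u) \<Rightarrow> ('n \<Rightarrow> 'z \<times> 'u \<Rightarrow> real)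
      \<Rightarrow> ('x \<times> ('y \<Rightarrow>\<^sub>L real) \<times> (real^'n)) set" where
  "CRD_solutions f F K V G g =
    {p \<in> CRD_feasible f F K V G g. \<forall>q\<in>CRD_feasible f F K V G g.
       CRD_objective f F q - CRD_objective f F p \<notin> K - {0}}"

definition CRD_weak_solutions ::
    "('w::real_normed_vector \<Rightarrow> 'y::real_normed_vector) \<Rightarrow> ('x::real_normed_vector \<Rightarrow> 'w)
      \<Rightarrow> 'y set \<Rightarrow> ('n::finite \<Rightarrow> 'v topology)
      \<Rightarrow> ('n \<Rightarrow> 'x \<times> 'v \<Rightarrow> 'z::real_normed_vector \<times> 'u) \<Rightarrow> ('n \<Rightarrow> 'z \<times> 'u \<Rightarrow> real)
      \<Rightarrow> ('x \<times> ('y \<Rightarrow>\<^sub>L real) \<times> (real^'n)) set" where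
  "CRD_weak_solutions f F K V G g =
    {p \<in> CRD_feasible f F K V G g. \<forall>q\<in>CRD_feasible f F K V G g.
       CRD_objective f F q - CRD_objective f F p \<notin> interior K}"


section \<open>Generalised convexity\<close>

text \<open>The direction \<open>\<nu>\<close> may depend on \<open>x\<close>, \<open>ys\<close>, \<open>ws\<close>, \<open>xs\<close>, but one \<open>\<nu>\<close> serves all choices
  \<open>(vs, qs, ps)\<close> of active parameters and constraint subgradients. If \<open>\<nu>\<close> could be chosen
  afresh for each such triple, nothing would follow for convex combinations of the
  subgradients \<open>ps i\<close>, hence nothing for the elements of \<open>Delta\<close>, and the optimality assertions
  would fail. For example, let \<open>f (F x) = x\<^sub>3\<close> on \<open>\<real>\<^sup>3\<close> with the two scenarios
  \<open>x\<^sub>1 - x\<^sub>2\<^sup>2 - x\<^sub>3 \<le> 0\<close> and \<open>- x\<^sub>1 - x\<^sub>2\<^sup>2 - x\<^sub>3 \<le> 0\<close> of one constraint: the scenario gradients are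
  nowhere parallel to that of the objective, so a suitable direction exists for each of them
  separately, and the KKT condition holds at \<open>0\<close>, but the problem is unbounded below.\<close>

definition type_I_pseudo_convex ::
    "('w::real_normed_vector \<Rightarrow> 'y::real_normed_vector) \<Rightarrow> ('x::real_normed_vector \<Rightarrow> 'w)
      \<Rightarrow> 'y set \<Rightarrow> ('n::finite \<Rightarrow> 'v topology)
      \<Rightarrow> ('n \<Rightarrow> 'x \<times> 'v \<Rightarrow> 'z::real_normed_vector \<times> 'u) \<Rightarrow> ('n \<Rightarrow> 'z \<times> 'u \<Rightarrow> real)
      \<Rightarrow> 'x \<Rightarrow> bool" where
  "type_I_pseudo_convex f F K V G g z \<longleftrightarrow>
    (\<forall>x. \<forall>ys \<in> dual_cone K.
     \<forall>ws \<in> limiting_subdiff (\<lambda>w. blinfun_apply ys (f w)) (F z).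
     \<forall>xs \<in> limiting_subdiff (\<lambda>x. blinfun_apply ws (F x)) z.
     \<exists>\<nu>. \<forall>vs qs ps.
       (\<forall>i. vs i \<in> active_params (V i) (G i) (g i) z \<and>
            qs i \<in> outer_subdiff (G i) (g i) z (vs i) \<and>
            ps i \<in> inner_subdiff (G i) (qs i) z (vs i)) \<longrightarrow>
       (blinfun_apply ys (f (F x)) < blinfun_apply ys (f (F z)) \<longrightarrow> blinfun_apply xs \<nu> < 0) \<and>
       (\<forall>i. g i (G i (x, vs i)) \<le> g i (G i (z, vs i)) \<longrightarrow> blinfun_apply (ps i) \<nu> \<le> 0))"

definition type_II_pseudo_convex ::
    "('w::real_normed_vector \<Rightarrow> 'y::real_normed_vector) \<Rightarrow> ('x::real_normed_vector \<Rightarrow> 'w)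
      \<Rightarrow> 'y set \<Rightarrow> ('n::finite \<Rightarrow> 'v topology)
      \<Rightarrow> ('n \<Rightarrow> 'x \<times> 'v \<Rightarrow> 'z::real_normed_vector \<times> 'u) \<Rightarrow> ('n \<Rightarrow> 'z \<times> 'u \<Rightarrow> real)
      \<Rightarrow> 'x \<Rightarrow> bool" where
  "type_II_pseudo_convex f F K V G g z \<longleftrightarrow>
    (\<forall>x \<in> - {z}. \<forall>ys \<in> dual_cone K - {0}.
     \<forall>ws \<in> limiting_subdiff (\<lambda>w. blinfun_apply ys (f w)) (F z).
     \<forall>xs \<in> limiting_subdiff (\<lambda>x. blinfun_apply ws (F x)) z.
     \<exists>\<nu>. \<forall>vs qs ps.
       (\<forall>i. vs i \<in> active_params (V i) (G i) (g i) z \<and>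
            qs i \<in> outer_subdiff (G i) (g i) z (vs i) \<and>
            ps i \<in> inner_subdiff (G i) (qs i) z (vs i)) \<longrightarrow>
       (blinfun_apply ys (f (F x)) \<le> blinfun_apply ys (f (F z)) \<longrightarrow> blinfun_apply xs \<nu> < 0) \<and>
       (\<forall>i. g i (G i (x, vs i)) \<le> g i (G i (z, vs i)) \<longrightarrow> blinfun_apply (ps i) \<nu> \<le> 0))"

end

theory Submission
  imports Defs
begin

(* Weak duality: every element of Delta is a weak* limit of convex combinations of subgradients
   at active parameters, and the set of functionals p with p \<nu> \<le> 0 is convex and weak*
   closed. A direction \<nu> supplied by pseudo convexity therefore makes every multiplier term of
   the dual inclusion nonpositive at \<nu>, so the objective term cannot be negative there.
   Strong duality applies this at xbar with the KKT multipliers. *)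

section \<open>Half-spaces and weak* closed convex hulls\<close>

lemma closedin_weak_star_halfspace:
  fixes \<nu> :: "'a::real_normed_vector"
  shows "closedin weak_star {p. blinfun_apply p \<nu> \<le> (c::real)}"
proof -
  have "continuous_map weak_star euclideanreal (\<lambda>p. blinfun_apply p \<nu>)"
    by (simp add: strong_operator_topology_continuous_evaluation)
  from closedin_continuous_map_preimage[OF this, of "{..c}"] show ?thesis
    by (simp add: strong_operator_topology_topspace)
qed

lemma clco_halfspace:
  assumes "p \<in> clco S" and "\<And>q. q \<in> S \<Longrightarrow> blinfun_apply q \<nu> \<le> c"
  shows "blinfun_apply p \<nu> \<le> c"
proof -
  have "convex {p. blinfun_apply p \<nu> \<le> c}"
    by (auto simp: convex_def blinfun.add_left blinfun.scaleR_left intro: convex_bound_le)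
  then have "convex hull S \<subseteq> {p. blinfun_apply p \<nu> \<le> c}"
    by (intro hull_minimal) (auto simp: assms(2))
  then have "clco S \<subseteq> {p. blinfun_apply p \<nu> \<le> c}"
    unfolding clco_def by (rule closure_of_minimal[OF _ closedin_weak_star_halfspace])
  with assms(1) show ?thesis by blast
qed

text \<open>The weak* topology has the whole dual space as carrier, so neither the hull nor the
  closure can create or lose points of an empty or nonempty set.\<close>

lemma clco_eq_empty_iff [simp]: "clco S = {} \<longleftrightarrow> S = {}"
  by (simp add: clco_def closure_of_eq_empty_gen strong_operator_topology_topspace disjnt_def)

lemma Delta_halfspace:
  assumes "p \<in> Delta V G g z"
    and "\<And>v q r. v \<in> active_params V G g z \<Longrightarrow> q \<in> outer_subdiff G g z v \<Longrightarrow>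
      r \<in> inner_subdiff G q z v \<Longrightarrow> blinfun_apply r \<nu> \<le> c"
  shows "blinfun_apply p \<nu> \<le> c"
  using assms(1) unfolding Delta_def by (rule clco_halfspace) (use assms(2) in blast)

text \<open>Pseudo convexity speaks only of families with an active parameter and subgradients at
  every index; this supplies the entry at one index.\<close>

lemma Delta_nonempty_witness:
  assumes "p \<in> Delta V G g z"
  obtains v q r where "v \<in> active_params V G g z" "q \<in> outer_subdiff G g z v"
    "r \<in> inner_subdiff G q z v"
proof -
  have "(\<Union>v \<in> active_params V G g z. \<Union>q \<in> outer_subdiff G g z v. inner_subdiff G q z v) \<noteq> {}"
    using assms unfolding Delta_def by (metis clco_eq_empty_iff empty_iff)
  with that show thesis by blast
qed

section \<open>Weak duality\<close>

text \<open>The hypothesis \<open>direction\<close> is what both types of pseudo convexity leave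
  once the premise on the objective holds. Since \<nu> is fixed before the constraint data, it can
  be tested against all generators of every \<open>Delta\<close>, and evaluating the dual inclusion
  at \<nu> gives a negative value for 0.\<close>

lemma CRD_feasible_no_descent_direction:
  assumes dual: "(z, ys, \<mu>) \<in> CRD_feasible f F K V G g"
    and primal: "x \<in> CRP_feasible V G g"
    and direction: "\<And>ws xs. ws \<in> limiting_subdiff (\<lambda>w. blinfun_apply ys (f w)) (F z) \<Longrightarrow>
      xs \<in> limiting_subdiff (\<lambda>x. blinfun_apply ws (F x)) z \<Longrightarrow>
      \<exists>\<nu>. \<forall>vs qs ps.
        (\<forall>i. vs i \<in> active_params (V i) (G i) (g i) z \<and>
             qs i \<in> outer_subdiff (G i) (g i) z (vs i) \<and>
             ps i \<in> inner_subdiff (G i) (qs i) z (vs i)) \<longrightarrow>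
        blinfun_apply xs \<nu> < 0 \<and>
        (\<forall>i. g i (G i (x, vs i)) \<le> g i (G i (z, vs i)) \<longrightarrow> blinfun_apply (ps i) \<nu> \<le> 0)"
  shows False
proof -
  have nonneg: "0 \<le> \<mu> $ i" for i
    using dual by (simp add: CRD_feasible_def)
  have slack: "0 \<le> \<mu> $ i * g i (G i (z, v))"
    if "v \<in> active_params (V i) (G i) (g i) z" for i v
    using dual that by (simp add: CRD_feasible_def)
  have "0 \<in> objective_subdiff f F ys z
      + (\<Sum>i\<in>UNIV. (\<lambda>p. \<mu> $ i *\<^sub>R p) ` Delta (V i) (G i) (g i) z)"
    using dual by (simp add: CRD_feasible_def)
  then obtain xs t where xs: "xs \<in> objective_subdiff f F ys z"
    and t: "t \<in> (\<Sum>i\<in>UNIV. (\<lambda>p. \<mu> $ i *\<^sub>R p) ` Delta (V i) (G i) (g i) z)"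
    and "0 = xs + t"
    by (rule set_plus_elim)
  from t obtain s where s: "\<forall>i. s i \<in> (\<lambda>p. \<mu> $ i *\<^sub>R p) ` Delta (V i) (G i) (g i) z"
    and "t = (\<Sum>i\<in>UNIV. s i)"
    by (auto simp: set_sum_alt)
  with \<open>0 = xs + t\<close> have zero: "0 = xs + (\<Sum>i\<in>UNIV. s i)"
    by simp
  from s have "\<forall>i. \<exists>p. p \<in> Delta (V i) (G i) (g i) z \<and> s i = \<mu> $ i *\<^sub>R p"
    by blast
  then obtain p where p: "\<And>i. p i \<in> Delta (V i) (G i) (g i) z"
    and s_eq: "\<And>i. s i = \<mu> $ i *\<^sub>R p i"
    by metis
  \<comment> \<open>This covers indices with zero multiplier too: scaling an empty set by 0 gives an
    empty set, so the inclusion forces every \<open>Delta\<close> to be nonempty.\<close>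
  have "\<forall>i. \<exists>v q r. v \<in> active_params (V i) (G i) (g i) z \<and>
      q \<in> outer_subdiff (G i) (g i) z v \<and> r \<in> inner_subdiff (G i) q z v"
    using p by (meson Delta_nonempty_witness)
  then obtain vs qs ps where base: "\<And>i. vs i \<in> active_params (V i) (G i) (g i) z \<and>
      qs i \<in> outer_subdiff (G i) (g i) z (vs i) \<and> ps i \<in> inner_subdiff (G i) (qs i) z (vs i)"
    by metis
  from xs obtain ws where "ws \<in> limiting_subdiff (\<lambda>w. blinfun_apply ys (f w)) (F z)"
    and "xs \<in> limiting_subdiff (\<lambda>x. blinfun_apply ws (F x)) z"
    by (auto simp: objective_subdiff_def)
  from direction[OF this] obtain \<nu> where \<nu>: "\<And>vs qs ps.
        (\<And>i. vs i \<in> active_params (V i) (G i) (g i) z \<and>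
             qs i \<in> outer_subdiff (G i) (g i) z (vs i) \<and>
             ps i \<in> inner_subdiff (G i) (qs i) z (vs i)) \<Longrightarrow>
        blinfun_apply xs \<nu> < 0 \<and>
        (\<forall>i. g i (G i (x, vs i)) \<le> g i (G i (z, vs i)) \<longrightarrow> blinfun_apply (ps i) \<nu> \<le> 0)"
    by metis
  have "\<mu> $ i * blinfun_apply (p i) \<nu> \<le> 0" for i
  \<comment> \<open>The dual sign condition bounds the constraint value at \<open>z\<close> only for
    a positive multiplier; for a zero one the term vanishes.\<close>
  proof (cases "\<mu> $ i = 0")
    case False
    with nonneg[of i] have pos: "0 < \<mu> $ i" by simp
    have "blinfun_apply (p i) \<nu> \<le> 0"
    proof (rule Delta_halfspace[OF p])
      fix v q r
      assume v: "v \<in> active_params (V i) (G i) (g i) z"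
        and q: "q \<in> outer_subdiff (G i) (g i) z v"
        and r: "r \<in> inner_subdiff (G i) q z v"
      have "g i (G i (x, v)) \<le> 0"
        using primal v by (auto simp: CRP_feasible_def active_params_def)
      also have "0 \<le> g i (G i (z, v))"
        using slack[OF v] pos by (simp add: zero_le_mult_iff)
      finally have "g i (G i (x, v)) \<le> g i (G i (z, v))" .
      \<comment> \<open>Replacing the entry of the base family at \<open>i\<close> turns an
        arbitrary triple \<open>v\<close>, \<open>q\<close>, \<open>r\<close> into part of an
        admissible family.\<close>
      moreover have "\<forall>j. g j (G j (x, (vs(i := v)) j)) \<le> g j (G j (z, (vs(i := v)) j)) \<longrightarrow>
          blinfun_apply ((ps(i := r)) j) \<nu> \<le> 0"
        by (rule \<nu>[of "vs(i := v)" "qs(i := q)" "ps(i := r)", THEN conjunct2])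
          (use base v q r in auto)
      ultimately show "blinfun_apply r \<nu> \<le> 0"
        by (auto dest: spec[of _ i])
    qed
    with pos show ?thesis by (simp add: mult_le_0_iff)
  qed simp
  then have "(\<Sum>i\<in>UNIV. \<mu> $ i * blinfun_apply (p i) \<nu>) \<le> 0"
    by (simp add: sum_nonpos)
  \<comment> \<open>This inequality also depends on an admissible family being available, which
    \<open>base\<close> provides.\<close>
  moreover have "blinfun_apply xs \<nu> < 0"
    using \<nu>[OF base] by blast
  moreover have "0 = blinfun_apply xs \<nu> + (\<Sum>i\<in>UNIV. \<mu> $ i * blinfun_apply (p i) \<nu>)"
    using arg_cong[OF zero, of "\<lambda>p. blinfun_apply p \<nu>"]
    by (simp add: s_eq blinfun.add_left blinfun.sum_left blinfun.scaleR_left)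
  ultimately show False by linarith
qed

lemma weak_duality_type_I:
  assumes dual: "(z, ys, \<mu>) \<in> CRD_feasible f F K V G g"
    and "x \<in> CRP_feasible V G g" and pc: "type_I_pseudo_convex f F K V G g z"
  shows "blinfun_apply ys (f (F z)) \<le> blinfun_apply ys (f (F x))"
proof (rule ccontr)
  assume "\<not> ?thesis"
  then have less: "blinfun_apply ys (f (F x)) < blinfun_apply ys (f (F z))" by simp
  have ys: "ys \<in> dual_cone K"
    using dual by (simp add: CRD_feasible_def)
  have "\<exists>\<nu>. \<forall>vs qs ps.
      (\<forall>i. vs i \<in> active_params (V i) (G i) (g i) z \<and>
           qs i \<in> outer_subdiff (G i) (g i) z (vs i) \<and>
           ps i \<in> inner_subdiff (G i) (qs i) z (vs i)) \<longrightarrow>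
      blinfun_apply xs \<nu> < 0 \<and>
      (\<forall>i. g i (G i (x, vs i)) \<le> g i (G i (z, vs i)) \<longrightarrow> blinfun_apply (ps i) \<nu> \<le> 0)"
    if "ws \<in> limiting_subdiff (\<lambda>w. blinfun_apply ys (f w)) (F z)"
      and "xs \<in> limiting_subdiff (\<lambda>x. blinfun_apply ws (F x)) z" for ws xs
    using bspec[OF bspec[OF bspec[OF spec[OF pc[unfolded type_I_pseudo_convex_def]] ys] that(1)] that(2),
      of x] less
    by simp
  then show False
    by (rule CRD_feasible_no_descent_direction[OF assms(1,2)])
qed

text \<open>The non-strict premise of type II makes even equal scalarized values contradictory,
  hence the strict conclusion. Distinct points are essential, as the inequality fails for
  \<open>x = z\<close>.\<close>

lemma weak_duality_type_II:
  assumes dual: "(z, ys, \<mu>) \<in> CRD_feasible f F K V G g"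
    and "x \<in> CRP_feasible V G g" and pc: "type_II_pseudo_convex f F K V G g z"
    and "x \<noteq> z"
  shows "blinfun_apply ys (f (F z)) < blinfun_apply ys (f (F x))"
proof (rule ccontr)
  assume "\<not> ?thesis"
  then have le: "blinfun_apply ys (f (F x)) \<le> blinfun_apply ys (f (F z))" by simp
  have xz: "x \<in> - {z}"
    using \<open>x \<noteq> z\<close> by simp
  have ys: "ys \<in> dual_cone K - {0}"
    using dual by (simp add: CRD_feasible_def)
  have "\<exists>\<nu>. \<forall>vs qs ps.
      (\<forall>i. vs i \<in> active_params (V i) (G i) (g i) z \<and>
           qs i \<in> outer_subdiff (G i) (g i) z (vs i) \<and>
           ps i \<in> inner_subdiff (G i) (qs i) z (vs i)) \<longrightarrow>
      blinfun_apply xs \<nu> < 0 \<and>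
      (\<forall>i. g i (G i (x, vs i)) \<le> g i (G i (z, vs i)) \<longrightarrow> blinfun_apply (ps i) \<nu> \<le> 0)"
    if "ws \<in> limiting_subdiff (\<lambda>w. blinfun_apply ys (f w)) (F z)"
      and "xs \<in> limiting_subdiff (\<lambda>x. blinfun_apply ws (F x)) z" for ws xs
    using bspec[OF bspec[OF bspec[OF
      bspec[OF pc[unfolded type_II_pseudo_convex_def] xz] ys] that(1)] that(2)] le
    by simp
  then show False
    by (rule CRD_feasible_no_descent_direction[OF assms(1,2)])
qed

section \<open>From the KKT condition to strong duality\<close>

text \<open>From an interior point one can move a little against a direction on which
  \<open>q\<close> is positive and remain in \<open>K\<close>; as \<open>q\<close> is still
  nonnegative there, it was positive at the start.\<close>

lemma dual_cone_interior_pos: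
  assumes q: "q \<in> dual_cone K - {0}" and y: "y \<in> interior K"
  shows "0 < blinfun_apply q y"
proof -
  from y obtain e where e: "0 < e" "cball y e \<subseteq> K"
    by (auto simp: mem_interior_cball)
  from q have "q \<noteq> 0" by simp
  then obtain d where "blinfun_apply q d \<noteq> 0"
    by (metis blinfun_eqI zero_blinfun.rep_eq)
  then obtain d where d: "blinfun_apply q d > 0"
    by (metis blinfun.minus_right linorder_neqE_linordered_idom neg_0_less_iff_less)
  then have "d \<noteq> 0" by auto
  \<comment> \<open>The displacement has norm exactly \<open>e\<close>, which the closed ball
    allows.\<close>
  with e have "y - (e / norm d) *\<^sub>R d \<in> K"
    by (intro subsetD[OF e(2)]) (simp add: dist_norm)
  then have "0 \<le> blinfun_apply q (y - (e / norm d) *\<^sub>R d)"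
    using q by (simp add: dual_cone_def)
  then have "(e / norm d) * blinfun_apply q d \<le> blinfun_apply q y"
    by (simp add: blinfun.diff_right blinfun.scaleR_right)
  moreover have "0 < (e / norm d) * blinfun_apply q d"
    using d e \<open>d \<noteq> 0\<close> by simp
  ultimately show ?thesis by linarith
qed

text \<open>At active parameters the constraint attains its worst value, so complementary slackness
  yields the dual sign condition, even with equality.\<close>

lemma KKT_CRD_feasible:
  assumes "robust_KKT f F K V G g xbar"
  obtains ys \<mu> where "(xbar, ys, \<mu>) \<in> CRD_feasible f F K V G g"
proof -
  from assms obtain ys \<mu> vbar where ys: "ys \<in> dual_cone K - {0}"
    and nonneg: "\<forall>i. 0 \<le> \<mu> $ i"
    and incl: "0 \<in> objective_subdiff f F ys xbar
      + (\<Sum>i\<in>UNIV. (\<lambda>p. \<mu> $ i *\<^sub>R p) ` Delta (V i) (G i) (g i) xbar)"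
    and slack: "\<forall>i. \<mu> $ i * worst_value (V i) (G i) (g i) xbar = \<mu> $ i * g i (G i (xbar, vbar i)) \<and>
      \<mu> $ i * g i (G i (xbar, vbar i)) = 0"
    unfolding robust_KKT_def by blast
  have "0 \<le> \<mu> $ i * worst_value (V i) (G i) (g i) xbar" for i
    using spec[OF slack, of i] by argo
  with ys nonneg incl have "(xbar, ys, \<mu>) \<in> CRD_feasible f F K V G g"
    by (simp add: CRD_feasible_def active_params_def)
  then show thesis by (rule that)
qed

theorem theorem4p3:
  fixes F :: "'x::banach \<Rightarrow> 'w::banach"
    and f :: "'w \<Rightarrow> 'y::banach"
    and K :: "'y set"
    and V :: "'n::finite \<Rightarrow> 'v topology"
    and U :: "'n \<Rightarrow> 'u topology"
    and G :: "'n \<Rightarrow> 'x \<times> 'v \<Rightarrow> 'z::banach \<times> 'u"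
    and g :: "'n \<Rightarrow> 'z \<times> 'u \<Rightarrow> real"
    and xbar :: 'x
  assumes asplund: "asplund TYPE('x)" "asplund TYPE('w)" "asplund TYPE('y)" "asplund TYPE('z)"
    and K: "pointed_closed_convex_cone K" "interior K \<noteq> {}"
    and V: "\<And>i. topspace (V i) \<noteq> {}" "\<And>i. seq_compact_space (V i)"
    and G: "\<And>i x v. v \<in> topspace (V i) \<Longrightarrow> snd (G i (x, v)) \<in> topspace (U i)"
    and A1: "assumption_A1 f F xbar"
    and A2: "\<And>i. assumption_A2 (V i) (G i) (g i) xbar"
    and A3: "\<And>i. assumption_A3 (V i) (U i) (G i) (g i) xbar"
    and A4: "assumption_A4 V G g xbar"
    and A5: "\<And>i. assumption_A5 (V i) (G i) (g i) xbar"
    and feasible: "xbar \<in> CRP_feasible V G g"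
    and KKT: "robust_KKT f F K V G g xbar"
  shows "\<exists>(ybar :: 'y \<Rightarrow>\<^sub>L real) (\<mu>bar :: real^'n).
    ybar \<in> dual_cone K - {0} \<and> (\<forall>i. 0 \<le> \<mu>bar $ i) \<and>
    (xbar, ybar, \<mu>bar) \<in> CRD_feasible f F K V G g \<and>
    ((\<forall>z. type_I_pseudo_convex f F K V G g z) \<longrightarrow>
       (xbar, ybar, \<mu>bar) \<in> CRD_weak_solutions f F K V G g \<and>
       xbar \<in> CRP_weak_solutions f F K V G g) \<and>
    ((\<forall>z. type_II_pseudo_convex f F K V G g z) \<longrightarrow>
       (xbar, ybar, \<mu>bar) \<in> CRD_solutions f F K V G g \<and>
       xbar \<in> CRP_solutions f F K V G g)"
proof -
  obtain ybar \<mu>bar where dual: "(xbar, ybar, \<mu>bar) \<in> CRD_feasible f F K V G g"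
    using KKT_CRD_feasible[OF KKT] .
  then have ybar: "ybar \<in> dual_cone K - {0}" and \<mu>bar: "\<forall>i. 0 \<le> \<mu>bar $ i"
    by (auto simp: CRD_feasible_def)
  have "(xbar, ybar, \<mu>bar) \<in> CRD_weak_solutions f F K V G g \<and>
      xbar \<in> CRP_weak_solutions f F K V G g"
    if pc: "\<forall>z. type_I_pseudo_convex f F K V G g z"
  proof
    \<comment> \<open>Here \<open>xbar\<close> is the primal point and the dual point varies; the
      functional \<open>ys\<close> of that dual point separates the values.\<close>
    have "f (F z) - f (F xbar) \<notin> interior K"
      if q: "(z, ys, \<mu>) \<in> CRD_feasible f F K V G g" for z ys \<mu>
    proof
      assume "f (F z) - f (F xbar) \<in> interior K"
      with q have "0 < blinfun_apply ys (f (F z) - f (F xbar))"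
        by (intro dual_cone_interior_pos[of ys K]) (simp_all add: CRD_feasible_def)
      with weak_duality_type_I[OF q feasible spec[OF pc]] show False
        by (simp add: blinfun.diff_right)
    qed
    with dual show "(xbar, ybar, \<mu>bar) \<in> CRD_weak_solutions f F K V G g"
      by (auto simp: CRD_weak_solutions_def CRD_objective_def)
    \<comment> \<open>The roles are exchanged: \<open>xbar\<close> with its KKT multipliers is the
      dual point, and \<open>ybar\<close> scalarizes for every feasible \<open>x\<close>.\<close>
    have "f (F x) - f (F xbar) \<notin> uminus ` interior K" if x: "x \<in> CRP_feasible V G g" for x
    proof
      assume "f (F x) - f (F xbar) \<in> uminus ` interior K"
      then obtain k where k: "k \<in> interior K" "f (F x) - f (F xbar) = - k" by blast
      have "0 \<le> blinfun_apply ybar (f (F x) - f (F xbar))"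
        using weak_duality_type_I[OF dual x spec[OF pc]] by (simp add: blinfun.diff_right)
      with k dual_cone_interior_pos[OF ybar k(1)] show False
        by (simp add: blinfun.minus_right)
    qed
    with feasible show "xbar \<in> CRP_weak_solutions f F K V G g"
      by (auto simp: CRP_weak_solutions_def)
  qed
  moreover have "(xbar, ybar, \<mu>bar) \<in> CRD_solutions f F K V G g \<and>
      xbar \<in> CRP_solutions f F K V G g"
    if pc: "\<forall>z. type_II_pseudo_convex f F K V G g z"
  proof
    have "f (F z) - f (F xbar) \<notin> K - {0}"
      if q: "(z, ys, \<mu>) \<in> CRD_feasible f F K V G g" for z ys \<mu>
    proof
      assume *: "f (F z) - f (F xbar) \<in> K - {0}"
      \<comment> \<open>A nonzero difference of values separates the points, as type II requires. On
        \<open>K\<close> itself \<open>ys\<close> is only nonnegative, so the strictness has to come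
        from weak duality.\<close>
      then have "xbar \<noteq> z" by auto
      from weak_duality_type_II[OF q feasible spec[OF pc] this] * q show False
        by (force simp: CRD_feasible_def dual_cone_def blinfun.diff_right)
    qed
    with dual show "(xbar, ybar, \<mu>bar) \<in> CRD_solutions f F K V G g"
      by (auto simp: CRD_solutions_def CRD_objective_def)
    have "f (F x) - f (F xbar) \<notin> uminus ` (K - {0})" if x: "x \<in> CRP_feasible V G g" for x
    proof
      assume "f (F x) - f (F xbar) \<in> uminus ` (K - {0})"
      then obtain k where k: "k \<in> K" "k \<noteq> 0" "f (F x) - f (F xbar) = - k" by blast
      then have "x \<noteq> xbar" by auto
      from weak_duality_type_II[OF dual x spec[OF pc] this]
      have "0 < blinfun_apply ybar (f (F x) - f (F xbar))"
        by (simp add: blinfun.diff_right)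
      then show False
        using ybar k by (auto simp: dual_cone_def blinfun.minus_right)
    qed
    with feasible show "xbar \<in> CRP_solutions f F K V G g"
      by (auto simp: CRP_solutions_def)
  qed
  ultimately show ?thesis
    using dual ybar \<mu>bar by blast
qed

end
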